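(* For every generalized effect algebra $(E;\oplus,0)$ the following conditions are equivalent: (i) there exists an order determining set $S$ of generalized states on $E$; (ii) there exists an order reflecting morphism $\varphi:E\to\mathcal{G}_D(\mathcal{H})$ for some complex Hilbert space $\mathcal{H}$ and some linear subspace $D\subseteq\mathcal{H}$ dense in $\mathcal{H}$; (iii) there exists a set $T$ and an order reflecting morphism from $E$ to $(\mathbb{R}^+_0)^T$.
   Context: A generalized effect algebra $(E;\oplus,0)$ is a set $E$ with an element $0\in E$ and a partial binary operation $\oplus$ such that for all $x,y,z\in E$: (GE1) $x\oplus y=y\oplus x$ if one side is defined; (GE2) $(x\oplus y)\oplus z=x\oplus(y\oplus z)$ if one side is defined; (GE3) $x\oplus y=x\oplus z$ implies $y=z$; (GE4) $x\oplus y=0$ implies $x=y=0$; (GE5) $x\oplus 0=x$. The partial order is: $x\le y$ iff there is $z$ with $x\oplus z$ defined and $x\oplus z=y$. A morphism $f:E_1\to E_2$ of generalized effect algebras is a map such that whenever $a\oplus_1 b$ is defined, $f(a)\oplus_2 f(b)$ is defined and equals $f(a\oplus_1 b)$. A morphism $f$ is order reflecting if $f(a)\le f(b)$ implies $a\le b$ for all $a,b\in E_1$. For a complex Hilbert space $\mathcal{H}$ (inner product linear in the second argument) and a dense linear subspace $D\subseteq\mathcal{H}$, $\mathcal{G}_D(\mathcal{H})$ is the set of all positive linear operators $A:D\to\mathcal{H}$ (i.e. $\langle \mathbf{x},A\mathbf{x}\rangle\ge 0$ for all $\mathbf{x}\in D$); with $\oplus$ the usual (everywhere defined) sum of operators on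 $D$ and $0$ the null operator it is a generalized effect algebra, in which $A\le B$ iff $B-A$ is positive. $\mathbb{R}^+_0$ is the set of nonnegative reals, a generalized effect algebra under usual addition; $(\mathbb{R}^+_0)^T$ carries componentwise addition (so its order is componentwise). A generalized state on $E$ is a morphism $s:E\to\mathbb{R}^+_0$. A set $S$ of generalized states on $E$ is order determining if ($s(a)\le s(b)$ for all $s\in S$) implies $a\le b$, for all $a,b\in E$. *)

theory Defs
  imports "HOL-Analysis.Analysis" "HOL-Library.Function_Algebras"
begin

text \<open>The partial operation is modelled by an option-valued function; \<open>None\<close> means undefined.\<close>

record 'a gea =
  gcarrier :: "'a set"
  gplus :: "'a \<Rightarrow> 'a \<Rightarrow> 'a option"
  gzero :: 'a

text \<open>In GE1 and GE2 the equality of options says that either both sides are undefined or both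
  are defined and equal.\<close>

locale generalized_effect_algebra =
  fixes E :: "'a gea"
  assumes gzero_closed: "gzero E \<in> gcarrier E"
    and gplus_closed: "\<lbrakk>x \<in> gcarrier E; y \<in> gcarrier E; gplus E x y = Some z\<rbrakk> \<Longrightarrow> z \<in> gcarrier E"
    and GE1: "\<lbrakk>x \<in> gcarrier E; y \<in> gcarrier E\<rbrakk> \<Longrightarrow> gplus E x y = gplus E y x"
    and GE2: "\<lbrakk>x \<in> gcarrier E; y \<in> gcarrier E; z \<in> gcarrier E\<rbrakk> \<Longrightarrow>
      Option.bind (gplus E x y) (\<lambda>u. gplus E u z) = Option.bind (gplus E y z) (\<lambda>v. gplus E x v)"
    and GE3: "\<lbrakk>x \<in> gcarrier E; y \<in> gcarrier E; z \<in> gcarrier E;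
      gplus E x y = Some w; gplus E x z = Some w\<rbrakk> \<Longrightarrow> y = z"
    and GE4: "\<lbrakk>x \<in> gcarrier E; y \<in> gcarrier E; gplus E x y = Some (gzero E)\<rbrakk> \<Longrightarrow>
      x = gzero E \<and> y = gzero E"
    and GE5: "x \<in> gcarrier E \<Longrightarrow> gplus E x (gzero E) = Some x"

definition gle :: "'a gea \<Rightarrow> 'a \<Rightarrow> 'a \<Rightarrow> bool" where
  "gle E x y \<longleftrightarrow> (\<exists>z \<in> gcarrier E. gplus E x z = Some y)"

definition gea_morphism :: "'a gea \<Rightarrow> 'b gea \<Rightarrow> ('a \<Rightarrow> 'b) \<Rightarrow> bool" where
  "gea_morphism E F f \<longleftrightarrow> f \<in> gcarrier E \<rightarrow> gcarrier F \<and>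
    (\<forall>a \<in> gcarrier E. \<forall>b \<in> gcarrier E. \<forall>c.
      gplus E a b = Some c \<longrightarrow> gplus F (f a) (f b) = Some (f c))"

definition order_reflecting :: "'a gea \<Rightarrow> 'b gea \<Rightarrow> ('a \<Rightarrow> 'b) \<Rightarrow> bool" where
  "order_reflecting E F f \<longleftrightarrow>
    (\<forall>a \<in> gcarrier E. \<forall>b \<in> gcarrier E. gle F (f a) (f b) \<longrightarrow> gle E a b)"

subsection \<open>Nonnegative reals, their powers, and generalized states\<close>

definition nonneg_real_gea :: "real gea" where
  "nonneg_real_gea = \<lparr>gcarrier = {0..}, gplus = (\<lambda>x y. Some (x + y)), gzero = 0\<rparr>"

text \<open>Functions on a set are represented by total functions that are \<open>undefined\<close> outside the set,
  so that equality in HOL is equality on the set.\<close>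

definition nonneg_real_power_gea :: "'t set \<Rightarrow> ('t \<Rightarrow> real) gea" where
  "nonneg_real_power_gea T = \<lparr>gcarrier = T \<rightarrow>\<^sub>E {0..},
    gplus = (\<lambda>f g. Some (\<lambda>t\<in>T. f t + g t)), gzero = (\<lambda>t\<in>T. 0)\<rparr>"

definition generalized_state :: "'a gea \<Rightarrow> ('a \<Rightarrow> real) \<Rightarrow> bool" where
  "generalized_state E s \<longleftrightarrow> gea_morphism E nonneg_real_gea s"

definition order_determining :: "'a gea \<Rightarrow> ('a \<Rightarrow> real) set \<Rightarrow> bool" where
  "order_determining E S \<longleftrightarrow>
    (\<forall>a \<in> gcarrier E. \<forall>b \<in> gcarrier E. (\<forall>s \<in> S. s a \<le> s b) \<longrightarrow> gle E a b)"

subsection \<open>Complex Hilbert spaces\<close>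

text \<open>The underlying set \<open>H\<close> is a linear subspace of an ambient complex vector space, possibly
  the whole space. The inner product is linear in the second argument and matters only on \<open>H\<close>.\<close>

locale complex_inner_product_space = vector_space scale
  for scale :: "complex \<Rightarrow> 'h::ab_group_add \<Rightarrow> 'h" +
  fixes H :: "'h set" and inner :: "'h \<Rightarrow> 'h \<Rightarrow> complex"
  assumes subspace_H: "subspace H"
    and inner_add_right:
      "\<lbrakk>x \<in> H; y \<in> H; z \<in> H\<rbrakk> \<Longrightarrow> inner x (y + z) = inner x y + inner x z"
    and inner_scale_right:
      "\<lbrakk>x \<in> H; y \<in> H\<rbrakk> \<Longrightarrow> inner x (scale c y) = c * inner x y"
    and inner_commute: "\<lbrakk>x \<in> H; y \<in> H\<rbrakk> \<Longrightarrow> inner x y = cnj (inner y x)"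
    and inner_nonneg: "x \<in> H \<Longrightarrow> inner x x \<in> \<real>\<^sub>\<ge>\<^sub>0"
    and inner_definite: "\<lbrakk>x \<in> H; inner x x = 0\<rbrakk> \<Longrightarrow> x = 0"
begin

definition hnorm :: "'h \<Rightarrow> real" where
  "hnorm x = sqrt (Re (inner x x))"

text \<open>The value \<open>0\<close> outside \<open>H\<close> is there because \<open>Metric_space\<close> asks for nonnegativity and symmetry
  of the distance on the whole type.\<close>

definition hdist :: "'h \<Rightarrow> 'h \<Rightarrow> real" where
  "hdist x y = (if x \<in> H \<and> y \<in> H then hnorm (x - y) else 0)"

lemma inner_add_left:
  "\<lbrakk>x \<in> H; y \<in> H; z \<in> H\<rbrakk> \<Longrightarrow> inner (x + y) z = inner x z + inner y z"
  by (metis complex_cnj_add inner_add_right inner_commute subspace_H subspace_add)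

lemma inner_scale_left:
  "\<lbrakk>x \<in> H; y \<in> H\<rbrakk> \<Longrightarrow> inner (scale c x) y = cnj c * inner x y"
  by (metis complex_cnj_mult inner_scale_right inner_commute subspace_H subspace_scale)

lemma inner_minus_right: "\<lbrakk>x \<in> H; y \<in> H\<rbrakk> \<Longrightarrow> inner x (- y) = - inner x y"
  using inner_scale_right[of x y "-1"] by simp

lemma inner_minus_left: "\<lbrakk>x \<in> H; y \<in> H\<rbrakk> \<Longrightarrow> inner (- x) y = - inner x y"
  using inner_scale_left[of x y "-1"] by simp

lemma inner_zero_right: "x \<in> H \<Longrightarrow> inner x 0 = 0"
  using inner_scale_right[of x x 0] by simp

lemma inner_self_of_real: "x \<in> H \<Longrightarrow> inner x x = of_real (Re (inner x x))"
  using inner_nonneg[of x] by (auto simp: complex_nonneg_Reals_iff complex_eq_iff)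

lemma Re_inner_nonneg: "x \<in> H \<Longrightarrow> 0 \<le> Re (inner x x)"
  using inner_nonneg[of x] by (simp add: complex_nonneg_Reals_iff)

lemma hnorm_square: "x \<in> H \<Longrightarrow> (hnorm x)\<^sup>2 = Re (inner x x)"
  by (simp add: hnorm_def Re_inner_nonneg)

lemma hnorm_nonneg: "x \<in> H \<Longrightarrow> 0 \<le> hnorm x"
  by (simp add: hnorm_def Re_inner_nonneg)

lemma hnorm_minus: "x \<in> H \<Longrightarrow> hnorm (- x) = hnorm x"
  by (simp add: hnorm_def inner_minus_right inner_minus_left subspace_H subspace_neg)

lemma hnorm_eq_0: "x \<in> H \<Longrightarrow> hnorm x = 0 \<longleftrightarrow> x = 0"
  using inner_self_of_real[of x] inner_definite[of x] inner_zero_right[of 0] Re_inner_nonneg[of x]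
  by (auto simp: hnorm_def)

lemma Re_inner_square_le:
  assumes x: "x \<in> H" and y: "y \<in> H"
  shows "(Re (inner x y))\<^sup>2 \<le> Re (inner x x) * Re (inner y y)"
proof (cases "Re (inner y y) = 0")
  case True
  then have "y = 0" using inner_definite[of y] inner_self_of_real[of y] y by simp
  then show ?thesis using inner_zero_right[OF x] inner_zero_right[OF y] by simp
next
  case False
  define q where "q = Re (inner y y)"
  define r where "r = Re (inner x y)"
  have q: "q > 0" using False Re_inner_nonneg[OF y] by (simp add: q_def)
  define t where "t = - r / q"
  let ?y = "scale (of_real t) y"
  have y': "?y \<in> H" using y subspace_H subspace_scale by blast
  have yx: "Re (inner y x) = r" using inner_commute[OF y x] by (simp add: r_def)
  have "0 \<le> Re (inner (x + ?y) (x + ?y))"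
    using Re_inner_nonneg x y' subspace_H subspace_add by blast
  also have "\<dots> = Re (inner x x) + 2 * t * r + t * t * q"
    using x y y' yx subspace_H subspace_add
    by (simp add: inner_add_left inner_add_right inner_scale_left inner_scale_right q_def r_def algebra_simps)
  also have "\<dots> = Re (inner x x) - r * r / q"
    using q by (simp add: t_def field_simps)
  finally show ?thesis using q by (simp add: field_simps power2_eq_square q_def r_def)
qed

lemma hnorm_triangle:
  assumes x: "x \<in> H" and y: "y \<in> H"
  shows "hnorm (x + y) \<le> hnorm x + hnorm y"
proof -
  have xy: "x + y \<in> H" using x y subspace_H subspace_add by blast
  have yx: "Re (inner y x) = Re (inner x y)" using inner_commute[OF y x] by simp
  have "(Re (inner x y))\<^sup>2 \<le> (hnorm x * hnorm y)\<^sup>2"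
    using Re_inner_square_le[OF x y] x y by (simp add: power_mult_distrib hnorm_square)
  then have "Re (inner x y) \<le> hnorm x * hnorm y"
    using x y hnorm_nonneg by (meson mult_nonneg_nonneg power2_le_imp_le)
  moreover have "(hnorm (x + y))\<^sup>2 = (hnorm x)\<^sup>2 + 2 * Re (inner x y) + (hnorm y)\<^sup>2"
    using x y xy yx by (simp add: hnorm_square inner_add_left inner_add_right)
  ultimately have "(hnorm (x + y))\<^sup>2 \<le> (hnorm x + hnorm y)\<^sup>2"
    by (simp add: power2_sum)
  then show ?thesis using x y hnorm_nonneg by (meson add_nonneg_nonneg power2_le_imp_le)
qed

sublocale metric: Metric_space H hdist
proof
  have d: "x - y \<in> H" if "x \<in> H" "y \<in> H" for x y
    using that subspace_H subspace_diff by blast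
  show "0 \<le> hdist x y" for x y
    by (simp add: hdist_def hnorm_nonneg d)
  show "hdist x y = hdist y x" for x y
    using hnorm_minus[of "x - y"] d by (auto simp: hdist_def)
  show "hdist x y = 0 \<longleftrightarrow> x = y" if "x \<in> H" "y \<in> H" for x y
    using that by (simp add: hdist_def hnorm_eq_0 d)
  show "hdist x z \<le> hdist x y + hdist y z" if "x \<in> H" "y \<in> H" "z \<in> H" for x y z
    using hnorm_triangle[of "x - y" "y - z"] that d by (simp add: hdist_def)
qed

definition dense_subspace :: "'h set \<Rightarrow> bool" where
  "dense_subspace D \<longleftrightarrow> subspace D \<and> D \<subseteq> H \<and> metric.mtopology closure_of D = H"

definition linear_operator_on :: "'h set \<Rightarrow> ('h \<Rightarrow> 'h) \<Rightarrow> bool" where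
  "linear_operator_on D A \<longleftrightarrow> A \<in> D \<rightarrow>\<^sub>E H \<and>
    (\<forall>x \<in> D. \<forall>y \<in> D. A (x + y) = A x + A y) \<and>
    (\<forall>c. \<forall>x \<in> D. A (scale c x) = scale c (A x))"

definition positive_on :: "'h set \<Rightarrow> ('h \<Rightarrow> 'h) \<Rightarrow> bool" where
  "positive_on D A \<longleftrightarrow> (\<forall>x \<in> D. inner x (A x) \<in> \<real>\<^sub>\<ge>\<^sub>0)"

definition positive_operator_gea :: "'h set \<Rightarrow> ('h \<Rightarrow> 'h) gea" where
  "positive_operator_gea D = \<lparr>gcarrier = {A. linear_operator_on D A \<and> positive_on D A},
    gplus = (\<lambda>A B. Some (\<lambda>x\<in>D. A x + B x)), gzero = (\<lambda>x\<in>D. 0)\<rparr>"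

end

locale complex_hilbert_space = complex_inner_product_space +
  assumes complete: "metric.mcomplete"

subsection \<open>The concrete structures are generalized effect algebras\<close>

lemma nonneg_real_gea: "generalized_effect_algebra nonneg_real_gea"
  by unfold_locales (auto simp: nonneg_real_gea_def)

lemma gle_nonneg_real_gea:
  "\<lbrakk>x \<ge> 0; y \<ge> 0\<rbrakk> \<Longrightarrow> gle nonneg_real_gea x y \<longleftrightarrow> x \<le> y"
  by (auto simp: nonneg_real_gea_def gle_def intro: bexI[of _ "y - x"])

lemma nonneg_real_power_gea: "generalized_effect_algebra (nonneg_real_power_gea T)"
proof
  fix f g h k
  let ?E = "nonneg_real_power_gea T"
  note [simp] = nonneg_real_power_gea_def
  show "gzero ?E \<in> gcarrier ?E" by auto
  assume f: "f \<in> gcarrier ?E"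
  then show "gplus ?E f (gzero ?E) = Some f" by (auto simp: fun_eq_iff PiE_iff extensional_def)
  assume g: "g \<in> gcarrier ?E"
  show "gplus ?E f g = Some h \<Longrightarrow> h \<in> gcarrier ?E" using f g by (fastforce simp: PiE_iff)
  show "gplus ?E f g = gplus ?E g f" by (simp add: add.commute)
  show "f = gzero ?E \<and> g = gzero ?E" if s: "gplus ?E f g = Some (gzero ?E)"
  proof -
    have "f t = 0 \<and> g t = 0" if t: "t \<in> T" for t
    proof -
      have eq: "(\<lambda>t\<in>T. f t + g t) = (\<lambda>t\<in>T. 0 :: real)" using s by simp
      have "f t + g t = 0" using fun_cong[OF eq, of t] t by simp
      moreover have "0 \<le> f t" "0 \<le> g t" using f g t by (auto simp: PiE_iff)
      ultimately show ?thesis by linarith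
    qed
    then show ?thesis using f g by (auto simp: fun_eq_iff PiE_iff extensional_def)
  qed
  assume h: "h \<in> gcarrier ?E"
  show "Option.bind (gplus ?E f g) (\<lambda>u. gplus ?E u h) = Option.bind (gplus ?E g h) (gplus ?E f)"
    by (auto simp: fun_eq_iff)
  show "g = h" if "gplus ?E f g = Some k" "gplus ?E f h = Some k"
  proof
    fix t
    have "(\<lambda>t\<in>T. f t + g t) t = (\<lambda>t\<in>T. f t + h t) t" using that by simp
    then show "g t = h t"
      using g h by (cases "t \<in> T") (auto simp: PiE_iff extensional_def)
  qed
qed

lemma gle_nonneg_real_power_gea:
  assumes "f \<in> T \<rightarrow>\<^sub>E {0..}" "g \<in> T \<rightarrow>\<^sub>E {0..}"
  shows "gle (nonneg_real_power_gea T) f g \<longleftrightarrow> (\<forall>t \<in> T. f t \<le> g t)"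
proof
  assume "gle (nonneg_real_power_gea T) f g"
  then show "\<forall>t \<in> T. f t \<le> g t" by (auto simp: gle_def nonneg_real_power_gea_def PiE_iff)
next
  assume "\<forall>t \<in> T. f t \<le> g t"
  then have "(\<lambda>t\<in>T. g t - f t) \<in> T \<rightarrow>\<^sub>E {0..}" by auto
  moreover have "(\<lambda>t\<in>T. f t + (\<lambda>t\<in>T. g t - f t) t) = g"
    using assms(2) by (auto simp: fun_eq_iff PiE_iff extensional_def)
  ultimately show "gle (nonneg_real_power_gea T) f g"
    unfolding gle_def nonneg_real_power_gea_def by (metis gea.select_convs(1,2))
qed

context complex_inner_product_space
begin

lemma dense_orthogonal_imp_zero:
  assumes D: "dense_subspace D" and v: "v \<in> H" and orth: "\<And>y. y \<in> D \<Longrightarrow> inner y v = 0"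
  shows "v = 0"
proof (rule ccontr)
  assume "v \<noteq> 0"
  then have pos: "0 < hnorm v" using hnorm_eq_0[OF v] hnorm_nonneg[OF v] by simp
  have "v \<in> metric.mtopology closure_of D" using D v by (simp add: dense_subspace_def)
  then obtain y where y: "y \<in> D" "hdist v y < hnorm v" using pos
    unfolding metric.metric_closure_of by auto
  have yH: "y \<in> H" using y D by (auto simp: dense_subspace_def)
  have vy: "v - y \<in> H" using v yH subspace_H subspace_diff by blast
  have "inner v y = 0" using inner_commute[OF v yH] orth[OF y(1)] by simp
  then have "Re (inner (v - y) (v - y)) = Re (inner v v) + Re (inner y y)"
    using v yH orth[OF y(1)] subspace_neg[OF subspace_H] subspace_add[OF subspace_H]
    using inner_add_left[of v "- y" "v + - y"] inner_add_right[of v v "- y"] inner_add_right[of "- y" v "- y"]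
    vy by (simp add: inner_minus_left inner_minus_right) (metis uminus_complex.sel(1))
  then have "hnorm v \<le> hnorm (v - y)" using Re_inner_nonneg[OF yH] by (simp add: hnorm_def)
  then show False using y v yH by (simp add: hdist_def)
qed

lemma quadratic_form_zero_imp_zero:
  assumes D: "dense_subspace D" and A: "linear_operator_on D A"
    and zero: "\<And>x. x \<in> D \<Longrightarrow> inner x (A x) = 0" and x: "x \<in> D"
  shows "A x = 0"
proof (rule dense_orthogonal_imp_zero[OF D])
  have DH: "D \<subseteq> H" and sD: "subspace D" using D by (auto simp: dense_subspace_def)
  have AH: "A z \<in> H" if "z \<in> D" for z using A that by (auto simp: linear_operator_on_def)
  show "A x \<in> H" using AH x .
  fix y assume y: "y \<in> D"
  have exp: "inner z (A x) + inner x (A z) = 0" if z: "z \<in> D" for z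
  proof -
    have "inner (z + x) (A (z + x)) = 0" using zero z x subspace_add[OF sD] by blast
    moreover have "A (z + x) = A z + A x" using A z x by (simp add: linear_operator_on_def)
    ultimately show ?thesis
      using DH z x AH zero[OF z] zero[OF x] subspace_add[OF subspace_H]
      by (simp add: inner_add_left inner_add_right subset_eq add.commute)
  qed
  have iy: "scale \<i> y \<in> D" using sD y subspace_scale by blast
  have "A (scale \<i> y) = scale \<i> (A y)" using A y by (simp add: linear_operator_on_def)
  then have "- \<i> * inner y (A x) + \<i> * inner x (A y) = 0"
    using exp[OF iy] DH x y AH by (simp add: inner_scale_left inner_scale_right subset_eq)
  then have "\<i> * (inner x (A y) - inner y (A x)) = 0" by (simp add: algebra_simps)
  then have "inner x (A y) = inner y (A x)" by simp
  then show "inner y (A x) = 0" using exp[OF y] by simp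
qed

lemma positive_operator_gea:
  assumes D: "dense_subspace D"
  shows "generalized_effect_algebra (positive_operator_gea D)"
proof
  have DH: "D \<subseteq> H" and sD: "subspace D" using D by (auto simp: dense_subspace_def)
  note DD = subspace_add[OF sD] subspace_scale[OF sD] subspace_add[OF subspace_H] subspace_scale[OF subspace_H]
  fix A B C F
  let ?E = "positive_operator_gea D"
  note [simp] = positive_operator_gea_def
  show "gzero ?E \<in> gcarrier ?E"
    using DH DD subspace_0[OF subspace_H]
    by (auto simp: linear_operator_on_def positive_on_def inner_zero_right subset_eq)
  assume A: "A \<in> gcarrier ?E"
  then show "gplus ?E A (gzero ?E) = Some A"
    by (auto simp: fun_eq_iff PiE_iff extensional_def linear_operator_on_def)
  assume B: "B \<in> gcarrier ?E"
  show "C \<in> gcarrier ?E" if "gplus ?E A B = Some C"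
  proof -
    have C: "C = (\<lambda>x\<in>D. A x + B x)" using that by simp
    have "linear_operator_on D C" using A B DD
      by (auto simp: C linear_operator_on_def scale_right_distrib PiE_iff algebra_simps)
    moreover have "positive_on D C"
    proof -
      have "inner x (A x + B x) \<in> \<real>\<^sub>\<ge>\<^sub>0" if x: "x \<in> D" for x
      proof -
        have "inner x (A x + B x) = inner x (A x) + inner x (B x)"
          using A B x DH by (intro inner_add_right) (auto simp: linear_operator_on_def)
        then show ?thesis using A B x by (simp add: positive_on_def nonneg_Reals_add_I)
      qed
      then show ?thesis by (simp add: positive_on_def C)
    qed
    ultimately show ?thesis by simp
  qed
  show "gplus ?E A B = gplus ?E B A" by (simp add: add.commute)
  show "A = gzero ?E \<and> B = gzero ?E" if s: "gplus ?E A B = Some (gzero ?E)"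
  proof -
    have z: "inner x (A x) = 0 \<and> inner x (B x) = 0" if x: "x \<in> D" for x
    proof -
      have "A x + B x = 0" using s x by (auto simp: fun_eq_iff dest!: spec[of _ x])
      moreover have "inner x (A x + B x) = inner x (A x) + inner x (B x)"
        using A B x DH by (intro inner_add_right) (auto simp: linear_operator_on_def)
      ultimately have "inner x (A x) + inner x (B x) = 0"
        using x DH inner_zero_right by auto
      moreover have "inner x (A x) \<in> \<real>\<^sub>\<ge>\<^sub>0" "inner x (B x) \<in> \<real>\<^sub>\<ge>\<^sub>0"
        using A B x by (auto simp: positive_on_def)
      ultimately show ?thesis
        by (auto simp: complex_nonneg_Reals_iff complex_eq_iff)
    qed
    have "A x = 0 \<and> B x = 0" if "x \<in> D" for x
      using quadratic_form_zero_imp_zero[OF D] A B z that by simp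
    then show ?thesis using A B
      by (auto simp: fun_eq_iff PiE_iff extensional_def linear_operator_on_def)
  qed
  assume C: "C \<in> gcarrier ?E"
  show "Option.bind (gplus ?E A B) (\<lambda>u. gplus ?E u C) = Option.bind (gplus ?E B C) (gplus ?E A)"
    by (auto simp: fun_eq_iff add.assoc)
  show "B = C" if s: "gplus ?E A B = Some F" "gplus ?E A C = Some F"
  proof
    fix x
    have "(\<lambda>x\<in>D. A x + B x) x = (\<lambda>x\<in>D. A x + C x) x" using s by simp
    then show "B x = C x"
      using B C by (cases "x \<in> D") (auto simp: PiE_iff extensional_def linear_operator_on_def)
  qed
qed

lemma gle_positive_operator_gea:
  assumes D: "dense_subspace D"
    and A: "A \<in> gcarrier (positive_operator_gea D)" and B: "B \<in> gcarrier (positive_operator_gea D)"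
  shows "gle (positive_operator_gea D) A B \<longleftrightarrow> positive_on D (\<lambda>x\<in>D. B x - A x)"
proof
  assume "gle (positive_operator_gea D) A B"
  then obtain C where C: "C \<in> gcarrier (positive_operator_gea D)" and BC: "B = (\<lambda>x\<in>D. A x + C x)"
    by (auto simp: gle_def positive_operator_gea_def)
  then show "positive_on D (\<lambda>x\<in>D. B x - A x)"
    by (simp add: positive_operator_gea_def positive_on_def)
next
  assume pos: "positive_on D (\<lambda>x\<in>D. B x - A x)"
  have sD: "subspace D" using D by (simp add: dense_subspace_def)
  have "linear_operator_on D (\<lambda>x\<in>D. B x - A x)"
    using A B subspace_add[OF sD] subspace_scale[OF sD] subspace_diff[OF subspace_H]
    by (auto simp: positive_operator_gea_def linear_operator_on_def scale_right_diff_distrib PiE_iff)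
  then have "(\<lambda>x\<in>D. B x - A x) \<in> gcarrier (positive_operator_gea D)"
    using pos by (simp add: positive_operator_gea_def)
  moreover have "gplus (positive_operator_gea D) A (\<lambda>x\<in>D. B x - A x) = Some B"
    using B by (auto simp: positive_operator_gea_def fun_eq_iff linear_operator_on_def PiE_iff extensional_def)
  ultimately show "gle (positive_operator_gea D) A B" unfolding gle_def by blast
qed

end

subsection \<open>The three conditions\<close>

definition has_order_determining_states :: "'a gea \<Rightarrow> bool" where
  "has_order_determining_states E \<longleftrightarrow>
    (\<exists>S. (\<forall>s \<in> S. generalized_state E s) \<and> order_determining E S)"

text \<open>HOL cannot quantify over types, so the type in which the Hilbert space \<open>H\<close>, respectively the
  index set \<open>T\<close>, lives is a parameter. Existence over all types is expressed in the theorem by a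
  fixed type built from the type of \<open>E\<close> which suffices whenever an arbitrary type does.\<close>

definition has_operator_representation :: "'h::ab_group_add itself \<Rightarrow> 'a gea \<Rightarrow> bool" where
  "has_operator_representation _ E \<longleftrightarrow>
    (\<exists>(scale :: complex \<Rightarrow> 'h \<Rightarrow> 'h) H inner D \<phi>.
      complex_hilbert_space scale H inner \<and>
      complex_inner_product_space.dense_subspace scale H inner D \<and>
      gea_morphism E (complex_inner_product_space.positive_operator_gea scale H inner D) \<phi> \<and>
      order_reflecting E (complex_inner_product_space.positive_operator_gea scale H inner D) \<phi>)"

definition has_power_representation :: "'t itself \<Rightarrow> 'a gea \<Rightarrow> bool" where
  "has_power_representation _ E \<longleftrightarrow>
    (\<exists>(T :: 't set) \<phi>.
      gea_morphism E (nonneg_real_power_gea T) \<phi> \<and>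
      order_reflecting E (nonneg_real_power_gea T) \<phi>)"

end

theory Submission
  imports Defs
begin

text \<open>Each vector \<open>x\<close> of \<open>D\<close> induces the generalized state \<open>a \<mapsto> \<langle>x, \<phi>(a) x\<rangle>\<close>, and comparing
  operators means comparing all these states. Conversely, a set \<open>S\<close> of states turns an element \<open>a\<close>
  into the diagonal operator multiplying the coordinate \<open>s\<close> by \<open>s(a)\<close>. This operator is unbounded
  in general, but it is defined on the finitely supported vectors of \<open>\<ell>\<^sup>2\<close>, and the quadratic form
  at the basis vector \<open>s\<close> recovers \<open>s(a)\<close>.\<close>

section \<open>The Hilbert space of square-summable functions\<close>

text \<open>Summation over the index type is unordered, so the index type may be uncountable. Being
  a subset of a function type, the space inherits pointwise addition and zero, and only scaling is
  defined separately.\<close>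

definition ell2 :: "('i \<Rightarrow> complex) set" where
  "ell2 = {f. (\<lambda>i. (cmod (f i))\<^sup>2) summable_on UNIV}"

definition ell2_scale :: "complex \<Rightarrow> ('i \<Rightarrow> complex) \<Rightarrow> 'i \<Rightarrow> complex" where
  "ell2_scale c f = (\<lambda>i. c * f i)"

definition ell2_inner :: "('i \<Rightarrow> complex) \<Rightarrow> ('i \<Rightarrow> complex) \<Rightarrow> complex" where
  "ell2_inner f g = (\<Sum>\<^sub>\<infinity>i. cnj (f i) * g i)"

definition finitely_supported :: "('i \<Rightarrow> complex) set" where
  "finitely_supported = {f. finite {i. f i \<noteq> 0}}"

section \<open>Linear structure and inner product\<close>

lemma vector_space_ell2_scale: "vector_space ell2_scale"
  by unfold_locales (auto simp: ell2_scale_def fun_eq_iff algebra_simps)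

text \<open>Bounded finite sums of nonnegative terms force summability. In the completeness proof
  only such finite sums are under control.\<close>

lemma ell2I_bounded_sums:
  assumes "\<And>F. finite F \<Longrightarrow> (\<Sum>i\<in>F. (cmod (f i))\<^sup>2) \<le> B"
  shows "f \<in> ell2"
  unfolding ell2_def mem_Collect_eq
  by (rule nonneg_bdd_above_summable_on) (auto intro!: bdd_aboveI2[where M = B] assms)

text \<open>Comparison with 2|f|^2 + 2|g|^2, which dominates because (|f| - |g|)^2 is
  nonnegative.\<close>

lemma ell2_add:
  assumes "f \<in> ell2" "g \<in> ell2"
  shows "f + g \<in> ell2"
proof -
  have "(\<lambda>i. 2 * (cmod (f i))\<^sup>2 + 2 * (cmod (g i))\<^sup>2) summable_on UNIV"
    using assms unfolding ell2_def
    by (intro summable_on_add summable_on_cmult_right) auto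
  moreover have "(cmod (f i + g i))\<^sup>2 \<le> 2 * (cmod (f i))\<^sup>2 + 2 * (cmod (g i))\<^sup>2" for i
  proof -
    have "(cmod (f i + g i))\<^sup>2 \<le> (cmod (f i) + cmod (g i))\<^sup>2"
      by (simp add: norm_triangle_ineq power_mono)
    also have "\<dots> \<le> 2 * (cmod (f i))\<^sup>2 + 2 * (cmod (g i))\<^sup>2"
      using zero_le_power2[of "cmod (f i) - cmod (g i)"]
      by (simp add: power2_eq_square algebra_simps)
    finally show ?thesis .
  qed
  ultimately show ?thesis
    unfolding ell2_def by (auto intro: summable_on_comparison_test)
qed

lemma ell2_scale_closed: "f \<in> ell2 \<Longrightarrow> ell2_scale c f \<in> ell2"
  by (simp add: ell2_def ell2_scale_def norm_mult power_mult_distrib summable_on_cmult_right)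

text \<open>Absolute convergence by comparison: |f||g| is at most |f|^2 + |g|^2, again because (|f|
  - |g|)^2 is nonnegative.\<close>

lemma ell2_inner_summable:
  assumes "f \<in> ell2" "g \<in> ell2"
  shows "(\<lambda>i. cnj (f i) * g i) summable_on UNIV"
proof -
  have "(\<lambda>i. (cmod (f i))\<^sup>2 + (cmod (g i))\<^sup>2) summable_on UNIV"
    using assms unfolding ell2_def by (intro summable_on_add) auto
  moreover have "cmod (cnj (f i) * g i) \<le> (cmod (f i))\<^sup>2 + (cmod (g i))\<^sup>2" for i
  proof -
    have "cmod (f i) * cmod (g i) \<le> 2 * (cmod (f i) * cmod (g i))" by simp
    also have "\<dots> \<le> (cmod (f i))\<^sup>2 + (cmod (g i))\<^sup>2"
      using zero_le_power2[of "cmod (f i) - cmod (g i)"]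
      by (simp add: power2_eq_square algebra_simps)
    finally show ?thesis by (simp add: norm_mult)
  qed
  ultimately have "(\<lambda>i. cmod (cnj (f i) * g i)) summable_on UNIV"
    by (auto intro: summable_on_comparison_test)
  then show ?thesis by (rule abs_summable_summable)
qed

text \<open>This covers non-summable \<open>f\<close> too, where both sums take the default value 0:
  composing with \<open>Re\<close> shows that summability is the same on both sides.\<close>

lemma infsum_complex_of_real: "infsum (\<lambda>i. complex_of_real (f i)) A = of_real (infsum f A)"
proof (rule infsum_bounded_linear_strong)
  show "bounded_linear complex_of_real" by (rule bounded_linear_of_real)
  show "(\<lambda>i. complex_of_real (f i)) summable_on A \<longleftrightarrow> f summable_on A"
    using summable_on_bounded_linear_iff[OF bounded_linear_of_real bounded_linear_Re, of f A] by simp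
qed

lemma ell2_inner_self:
  "ell2_inner f f = of_real (\<Sum>\<^sub>\<infinity>i. (cmod (f i))\<^sup>2)"
proof -
  have "cnj (f i) * f i = complex_of_real ((cmod (f i))\<^sup>2)" for i
    by (metis complex_norm_square mult.commute)
  then show ?thesis unfolding ell2_inner_def by (simp only: infsum_complex_of_real)
qed

lemma sum_le_ell2_inner:
  assumes "f \<in> ell2" "finite F"
  shows "(\<Sum>i\<in>F. (cmod (f i))\<^sup>2) \<le> Re (ell2_inner f f)"
  unfolding ell2_inner_self using assms
  by (auto simp: ell2_def intro!: finite_sum_le_infsum)

interpretation ell2: complex_inner_product_space ell2_scale ell2 ell2_inner
proof (rule complex_inner_product_space.intro[OF vector_space_ell2_scale])
  interpret vector_space ell2_scale by (rule vector_space_ell2_scale)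
  show "complex_inner_product_space_axioms ell2_scale (ell2 :: ('i \<Rightarrow> complex) set) ell2_inner"
  proof
    fix x y z :: "'i \<Rightarrow> complex" and c
    show "subspace (ell2 :: ('i \<Rightarrow> complex) set)"
      by (auto intro!: subspaceI ell2_add ell2_scale_closed) (simp add: ell2_def)
    assume x: "x \<in> ell2"
    show "ell2_inner x x \<in> \<real>\<^sub>\<ge>\<^sub>0"
      by (auto simp: ell2_inner_self intro!: infsum_nonneg)
    show "x = 0" if "ell2_inner x x = 0"
    proof
      fix i
      \<comment> \<open>A single coordinate is already bounded by the whole sum, so it vanishes with
        the norm.\<close>
      have "(cmod (x i))\<^sup>2 \<le> 0" using sum_le_ell2_inner[OF x, of "{i}"] that by simp
      then show "x i = 0 i" by simp
    qed
    assume y: "y \<in> ell2"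
    show "ell2_inner x (ell2_scale c y) = c * ell2_inner x y"
      using ell2_inner_summable[OF x y]
      by (simp add: ell2_inner_def ell2_scale_def mult.left_commute infsum_cmult_right)
    show "ell2_inner x y = cnj (ell2_inner y x)"
      by (simp add: ell2_inner_def mult.commute flip: infsum_cnj)
    assume z: "z \<in> ell2"
    show "ell2_inner x (y + z) = ell2_inner x y + ell2_inner x z"
      using ell2_inner_summable[OF x y] ell2_inner_summable[OF x z]
      by (simp add: ell2_inner_def algebra_simps infsum_add)
  qed
qed

section \<open>The norm through finite sums, and completeness\<close>

text \<open>A sum of nonnegative terms is the supremum of its finite partial sums. Norm estimates
  thus become estimates of finite sums, through which pointwise limits pass.\<close>

lemma ell2_hnorm_le_iff:
  assumes "f \<in> ell2" "B \<ge> 0"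
  shows "ell2.hnorm f \<le> B \<longleftrightarrow> (\<forall>F. finite F \<longrightarrow> (\<Sum>i\<in>F. (cmod (f i))\<^sup>2) \<le> B\<^sup>2)"
proof -
  have "ell2.hnorm f \<le> B \<longleftrightarrow> Re (ell2_inner f f) \<le> B\<^sup>2"
    unfolding ell2.hnorm_def using assms(2)
    by (metis real_sqrt_le_iff real_sqrt_abs abs_of_nonneg)
  also have "\<dots> \<longleftrightarrow> (\<forall>F. finite F \<longrightarrow> (\<Sum>i\<in>F. (cmod (f i))\<^sup>2) \<le> B\<^sup>2)"
    using sum_le_ell2_inner[OF assms(1)] assms(1)
    by (auto simp: ell2_inner_self ell2_def intro: order_trans infsum_le_finite_sums)
  finally show ?thesis .
qed

lemma ell2_diff: "f \<in> ell2 \<Longrightarrow> g \<in> ell2 \<Longrightarrow> f - g \<in> ell2"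
  using ell2.subspace_diff[OF ell2.subspace_H] .

lemma ell2_hdist_le_iff:
  assumes "f \<in> ell2" "g \<in> ell2" "B \<ge> 0"
  shows "ell2.hdist f g \<le> B \<longleftrightarrow>
    (\<forall>F. finite F \<longrightarrow> (\<Sum>i\<in>F. (cmod (f i - g i))\<^sup>2) \<le> B\<^sup>2)"
  using ell2_hnorm_le_iff[OF ell2_diff[OF assms(1,2)] assms(3)] assms(1,2)
  by (simp add: ell2.hdist_def)

text \<open>A Cauchy sequence converges in each coordinate. The Cauchy estimate, read on finite
  sums, survives in the limit and yields both membership of the pointwise limit and convergence in
  norm.\<close>

lemma ell2_mcomplete: "ell2.metric.mcomplete TYPE('i)"
  unfolding ell2.metric.mcomplete_def
proof (intro allI impI)
  fix \<sigma> :: "nat \<Rightarrow> 'i \<Rightarrow> complex"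
  assume "ell2.metric.MCauchy \<sigma>"
  then have \<sigma>: "\<sigma> n \<in> ell2"
    and cauchy: "\<epsilon> > 0 \<Longrightarrow> \<exists>N. \<forall>n n'. N \<le> n \<longrightarrow> N \<le> n' \<longrightarrow> ell2.hdist (\<sigma> n) (\<sigma> n') < \<epsilon>"
    for n \<epsilon>
    unfolding ell2.metric.MCauchy_def by auto
  have "Cauchy (\<lambda>n. \<sigma> n i)" for i
  proof (rule metric_CauchyI)
    fix \<epsilon> :: real
    assume "\<epsilon> > 0"
    then obtain N where N: "\<forall>n n'. N \<le> n \<longrightarrow> N \<le> n' \<longrightarrow> ell2.hdist (\<sigma> n) (\<sigma> n') < \<epsilon>"
      using cauchy by blast
    have "dist (\<sigma> m i) (\<sigma> n i) < \<epsilon>" if "m \<ge> N" "n \<ge> N" for m n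
    proof -
      \<comment> \<open>The characterization by finite sums concerns non-strict bounds; taking the
        distance itself as \<open>B\<close> keeps the strict inequality
        \<open>B < \<epsilon>\<close>.\<close>
      define B where "B = ell2.hdist (\<sigma> m) (\<sigma> n)"
      have "B \<ge> 0" unfolding B_def by (rule ell2.metric.nonneg)
      have "ell2.hdist (\<sigma> m) (\<sigma> n) \<le> B" by (simp add: B_def)
      then have "(\<Sum>j\<in>{i}. (cmod (\<sigma> m j - \<sigma> n j))\<^sup>2) \<le> B\<^sup>2"
        unfolding ell2_hdist_le_iff[OF \<sigma> \<sigma> \<open>B \<ge> 0\<close>] by blast
      then have "(cmod (\<sigma> m i - \<sigma> n i))\<^sup>2 \<le> B\<^sup>2" by simp
      then have "cmod (\<sigma> m i - \<sigma> n i) \<le> B" using \<open>B \<ge> 0\<close> by (rule power2_le_imp_le)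
      moreover have "B < \<epsilon>" using N that by (simp add: B_def)
      ultimately show ?thesis by (simp add: dist_norm)
    qed
    then show "\<exists>N. \<forall>m\<ge>N. \<forall>n\<ge>N. dist (\<sigma> m i) (\<sigma> n i) < \<epsilon>" by blast
  qed
  then have "\<forall>i. \<exists>l. (\<lambda>n. \<sigma> n i) \<longlonglongrightarrow> l"
    by (simp add: Cauchy_convergent_iff convergent_def)
  then obtain g where g: "(\<lambda>n. \<sigma> n i) \<longlonglongrightarrow> g i" for i by metis
  \<comment> \<open>\<open>N\<close> must not depend on \<open>F\<close>. With \<open>n\<close>
    fixed, the second index tends to infinity inside each finite sum, and the Cauchy bound remains
    as a non-strict one.\<close>
  have tail: "\<exists>N. \<forall>n\<ge>N. \<forall>F. finite F \<longrightarrow> (\<Sum>i\<in>F. (cmod (\<sigma> n i - g i))\<^sup>2) \<le> \<epsilon>\<^sup>2"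
    if \<epsilon>: "\<epsilon> > 0" for \<epsilon>
  proof -
    obtain N where N: "\<forall>n n'. N \<le> n \<longrightarrow> N \<le> n' \<longrightarrow> ell2.hdist (\<sigma> n) (\<sigma> n') < \<epsilon>"
      using cauchy[OF \<epsilon>] by blast
    have "(\<Sum>i\<in>F. (cmod (\<sigma> n i - g i))\<^sup>2) \<le> \<epsilon>\<^sup>2" if "n \<ge> N" "finite F" for n F
    proof (rule tendsto_upperbound)
      show "(\<lambda>m. \<Sum>i\<in>F. (cmod (\<sigma> n i - \<sigma> m i))\<^sup>2) \<longlonglongrightarrow> (\<Sum>i\<in>F. (cmod (\<sigma> n i - g i))\<^sup>2)"
        by (intro tendsto_intros g)
      have "(\<Sum>i\<in>F. (cmod (\<sigma> n i - \<sigma> m i))\<^sup>2) \<le> \<epsilon>\<^sup>2" if "m \<ge> N" for m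
      proof -
        have "ell2.hdist (\<sigma> n) (\<sigma> m) \<le> \<epsilon>"
          using N \<open>n \<ge> N\<close> \<open>m \<ge> N\<close> less_imp_le by blast
        then show ?thesis
          using ell2_hdist_le_iff[OF \<sigma>[of n] \<sigma>[of m], of \<epsilon>] \<epsilon> \<open>finite F\<close> by simp
      qed
      then show "\<forall>\<^sub>F m in sequentially. (\<Sum>i\<in>F. (cmod (\<sigma> n i - \<sigma> m i))\<^sup>2) \<le> \<epsilon>\<^sup>2"
        using eventually_sequentially by blast
    qed simp
    then show ?thesis by blast
  qed
  \<comment> \<open>Any positive radius would do here: the bound puts \<open>\<sigma> N - g\<close>
    into the space, and \<open>g\<close> is \<open>\<sigma> N\<close> minus this difference.\<close>
  obtain N where "\<forall>n\<ge>N. \<forall>F. finite F \<longrightarrow> (\<Sum>i\<in>F. (cmod (\<sigma> n i - g i))\<^sup>2) \<le> 1\<^sup>2"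
    using tail[of 1] by auto
  then have "\<sigma> N - g \<in> ell2"
    by (intro ell2I_bounded_sums[where B = 1]) simp
  from ell2_diff[OF \<sigma>[of N] this] have gH: "g \<in> ell2" by simp
  have "\<exists>N. \<forall>n\<ge>N. \<sigma> n \<in> ell2 \<and> ell2.hdist (\<sigma> n) g < \<epsilon>" if \<epsilon>: "\<epsilon> > 0" for \<epsilon>
  proof -
    \<comment> \<open>Halving \<epsilon> turns the non-strict bound into the strict one that
      convergence asks for.\<close>
    obtain N where N: "\<forall>n\<ge>N. \<forall>F. finite F \<longrightarrow> (\<Sum>i\<in>F. (cmod (\<sigma> n i - g i))\<^sup>2) \<le> (\<epsilon>/2)\<^sup>2"
      using tail[of "\<epsilon>/2"] \<epsilon> by auto
    have "ell2.hdist (\<sigma> n) g \<le> \<epsilon>/2" if "n \<ge> N" for n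
      using N that \<epsilon> ell2_hdist_le_iff[OF \<sigma>[of n] gH, of "\<epsilon>/2"] by simp
    moreover have "\<epsilon>/2 < \<epsilon>" using \<epsilon> by simp
    ultimately show ?thesis using \<sigma> le_less_trans by blast
  qed
  then show "\<exists>x. limitin ell2.metric.mtopology \<sigma> x sequentially"
    unfolding ell2.metric.limit_metric_sequentially using gH by blast
qed

lemma complex_hilbert_space_ell2: "complex_hilbert_space ell2_scale ell2 ell2_inner"
  by (intro complex_hilbert_space.intro complex_hilbert_space_axioms.intro
      ell2.complex_inner_product_space_axioms ell2_mcomplete)

section \<open>Density of the finitely supported vectors\<close>

lemma finitely_supported_subset_ell2: "finitely_supported \<subseteq> ell2"
proof
  fix f :: "'i \<Rightarrow> complex"
  assume "f \<in> finitely_supported"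
  then have "(\<lambda>i. (cmod (f i))\<^sup>2) summable_on {i. f i \<noteq> 0}"
    by (simp add: finitely_supported_def summable_on_finite)
  also have "?this \<longleftrightarrow> (\<lambda>i. (cmod (f i))\<^sup>2) summable_on UNIV"
    by (rule summable_on_cong_neutral) auto
  finally show "f \<in> ell2" by (simp add: ell2_def)
qed

lemma dense_finitely_supported: "ell2.dense_subspace finitely_supported"
  unfolding ell2.dense_subspace_def
proof (intro conjI)
  show "ell2.subspace (finitely_supported :: ('i \<Rightarrow> complex) set)"
  proof (rule ell2.subspaceI)
    fix f g :: "'i \<Rightarrow> complex" and c
    show "0 \<in> (finitely_supported :: ('i \<Rightarrow> complex) set)"
      by (simp add: finitely_supported_def)
    assume f: "f \<in> finitely_supported"
    then show "ell2_scale c f \<in> finitely_supported"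
      by (auto simp: finitely_supported_def ell2_scale_def elim: rev_finite_subset)
    assume g: "g \<in> finitely_supported"
    have "{i. (f + g) i \<noteq> 0} \<subseteq> {i. f i \<noteq> 0} \<union> {i. g i \<noteq> 0}" by auto
    then show "f + g \<in> finitely_supported"
      using f g unfolding finitely_supported_def by (auto intro: finite_subset)
  qed
  show "finitely_supported \<subseteq> ell2" by (rule finitely_supported_subset_ell2)
  show "ell2.metric.mtopology closure_of finitely_supported = (ell2 :: ('i \<Rightarrow> complex) set)"
  proof
    show "ell2.metric.mtopology closure_of finitely_supported \<subseteq> (ell2 :: ('i \<Rightarrow> complex) set)"
      unfolding ell2.metric.metric_closure_of by auto
    show "(ell2 :: ('i \<Rightarrow> complex) set) \<subseteq> ell2.metric.mtopology closure_of finitely_supported"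
    proof
      fix f :: "'i \<Rightarrow> complex"
      assume f: "f \<in> ell2"
      have "\<exists>g\<in>finitely_supported. g \<in> ell2.metric.mball f \<epsilon>" if \<epsilon>: "\<epsilon> > 0" for \<epsilon>
      proof -
        let ?T = "\<Sum>\<^sub>\<infinity>i. (cmod (f i))\<^sup>2"
        have sf: "(\<lambda>i. (cmod (f i))\<^sup>2) summable_on UNIV" using f by (simp add: ell2_def)
        \<comment> \<open>Some finite \<open>F\<close> carries all but less than (\<epsilon>/2)^2 of
          the total; truncating \<open>f\<close> to \<open>F\<close> gives the approximant.\<close>
        have "(sum (\<lambda>i. (cmod (f i))\<^sup>2) \<longlongrightarrow> ?T) (finite_subsets_at_top UNIV)"
          using has_sum_infsum[OF sf] by (simp add: has_sum_def)
        moreover have "?T - (\<epsilon>/2)\<^sup>2 < ?T" using \<epsilon> by simp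
        ultimately have "\<forall>\<^sub>F F in finite_subsets_at_top UNIV. ?T - (\<epsilon>/2)\<^sup>2 < (\<Sum>i\<in>F. (cmod (f i))\<^sup>2)"
          by (rule order_tendstoD(1))
        then obtain F where F: "finite F" "?T - (\<epsilon>/2)\<^sup>2 < (\<Sum>i\<in>F. (cmod (f i))\<^sup>2)"
          by (auto simp: eventually_finite_subsets_at_top)
        define g where "g = (\<lambda>i. if i \<in> F then f i else 0)"
        have gD: "g \<in> finitely_supported"
          using F(1) by (auto simp: g_def finitely_supported_def)
        then have gH: "g \<in> ell2" using finitely_supported_subset_ell2 by auto
        have "(\<Sum>i\<in>G. (cmod (f i - g i))\<^sup>2) \<le> (\<epsilon>/2)\<^sup>2" if G: "finite G" for G
        proof -
          \<comment> \<open>The difference is 0 on \<open>F\<close> and \<open>f\<close> off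
            \<open>F\<close>. The sums over \<open>G - F\<close> and \<open>F\<close> together stay
            below the total, so the first is at most what \<open>F\<close> misses.\<close>
          have "(\<Sum>i\<in>G. (cmod (f i - g i))\<^sup>2) = (\<Sum>i\<in>G - F. (cmod (f i))\<^sup>2)"
            using G by (intro sum.mono_neutral_cong_right) (auto simp: g_def)
          moreover have "(\<Sum>i\<in>G - F. (cmod (f i))\<^sup>2) + (\<Sum>i\<in>F. (cmod (f i))\<^sup>2)
              = (\<Sum>i\<in>(G - F) \<union> F. (cmod (f i))\<^sup>2)"
            using F(1) G by (intro sum.union_disjoint[symmetric]) auto
          moreover have "(\<Sum>i\<in>(G - F) \<union> F. (cmod (f i))\<^sup>2) \<le> ?T"
            using F(1) G sf by (intro finite_sum_le_infsum) auto
          ultimately show ?thesis using F(2) by linarith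
        qed
        then have "ell2.hdist f g \<le> \<epsilon>/2"
          using ell2_hdist_le_iff[OF f gH, of "\<epsilon>/2"] \<epsilon> by simp
        then show ?thesis using gD gH f \<epsilon> by (auto intro!: bexI[of _ g])
      qed
      then show "f \<in> ell2.metric.mtopology closure_of finitely_supported"
        unfolding ell2.metric.metric_closure_of using f by auto
    qed
  qed
qed

section \<open>Diagonal operators\<close>

text \<open>The value is \<open>undefined\<close> outside the domain, as membership in the operator
  structure requires. The coefficients are real because they will be values of states.\<close>

definition diagonal_operator :: "('i \<Rightarrow> real) \<Rightarrow> ('i \<Rightarrow> complex) \<Rightarrow> 'i \<Rightarrow> complex" where
  "diagonal_operator d = (\<lambda>x\<in>finitely_supported. \<lambda>i. of_real (d i) * x i)"

text \<open>The quadratic form is a weighted sum of squares, so the signs of the coefficients decide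
  positivity. The formula is also applied to a difference of coefficient families, whose sign is not
  known beforehand.\<close>

lemma ell2_inner_diagonal_operator:
  assumes "x \<in> finitely_supported"
  shows "ell2_inner x (diagonal_operator d x) = of_real (\<Sum>\<^sub>\<infinity>i. d i * (cmod (x i))\<^sup>2)"
proof -
  have "cnj (x i) * (of_real (d i) * x i) = complex_of_real (d i * (cmod (x i))\<^sup>2)" for i
    by (simp add: mult.left_commute complex_norm_square mult.commute del: of_real_power)
  then show ?thesis
    using assms by (simp only: ell2_inner_def diagonal_operator_def restrict_apply' infsum_complex_of_real)
qed

text \<open>Multiplication cannot enlarge the support, so images stay finitely supported and hence
  square-summable, however fast \<open>d\<close> grows.\<close>

lemma diagonal_operator_in_carrier:
  assumes "\<And>i. d i \<ge> 0"
  shows "diagonal_operator d \<in> gcarrier (ell2.positive_operator_gea finitely_supported)"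
proof -
  note sub = dense_finitely_supported[unfolded ell2.dense_subspace_def, THEN conjunct1]
  have "diagonal_operator d x \<in> ell2" if "x \<in> finitely_supported" for x
  proof (rule subsetD[OF finitely_supported_subset_ell2])
    show "diagonal_operator d x \<in> finitely_supported"
      using that by (auto simp: diagonal_operator_def finitely_supported_def elim: rev_finite_subset)
  qed
  moreover have "diagonal_operator d \<in> extensional finitely_supported"
    by (simp add: diagonal_operator_def)
  moreover have "diagonal_operator d (x + y) = diagonal_operator d x + diagonal_operator d y"
    if "x \<in> finitely_supported" "y \<in> finitely_supported" for x y
    using that ell2.subspace_add[OF sub that]
    by (simp add: diagonal_operator_def fun_eq_iff algebra_simps)
  moreover have "diagonal_operator d (ell2_scale c x) = ell2_scale c (diagonal_operator d x)"
    if "x \<in> finitely_supported" for c x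
    using that ell2.subspace_scale[OF sub that]
    by (simp add: diagonal_operator_def ell2_scale_def fun_eq_iff)
  ultimately have "ell2.linear_operator_on finitely_supported (diagonal_operator d)"
    unfolding ell2.linear_operator_on_def PiE_iff by blast
  moreover have "ell2.positive_on finitely_supported (diagonal_operator d)"
    using assms
    by (auto simp: ell2.positive_on_def ell2_inner_diagonal_operator intro!: infsum_nonneg)
  ultimately show ?thesis by (simp add: ell2.positive_operator_gea_def)
qed

text \<open>The difference of the two operators is diagonal with coefficients
  \<open>e j - d j\<close>, and its quadratic form at the basis vector of index \<open>i\<close> is
  \<open>e i - d i\<close>.\<close>

lemma gle_diagonal_operator_imp_le:
  assumes "\<And>i. d i \<ge> 0" "\<And>i. e i \<ge> 0"
    and "gle (ell2.positive_operator_gea finitely_supported) (diagonal_operator d) (diagonal_operator e)"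
  shows "d i \<le> e i"
proof -
  let ?x = "\<lambda>j. if j = i then 1 else 0 :: complex"
  let ?diff = "diagonal_operator (\<lambda>j. e j - d j)"
  have x: "?x \<in> finitely_supported" by (simp add: finitely_supported_def)
  have "?diff = (\<lambda>x\<in>finitely_supported. diagonal_operator e x - diagonal_operator d x)"
    by (auto simp: diagonal_operator_def fun_eq_iff algebra_simps)
  then have "ell2.positive_on finitely_supported ?diff"
    using assms(3) ell2.gle_positive_operator_gea[OF dense_finitely_supported
        diagonal_operator_in_carrier[of d] diagonal_operator_in_carrier[of e]] assms(1,2)
    by simp
  then have "ell2_inner ?x (?diff ?x) \<in> \<real>\<^sub>\<ge>\<^sub>0"
    using x by (auto simp: ell2.positive_on_def)
  moreover have "(\<Sum>\<^sub>\<infinity>j. (e j - d j) * (cmod (?x j))\<^sup>2) = (\<Sum>\<^sub>\<infinity>j\<in>{i}. (e j - d j) * (cmod (?x j))\<^sup>2)"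
    by (rule infsum_cong_neutral) auto
  ultimately show ?thesis
    by (simp add: ell2_inner_diagonal_operator[OF x] flip: of_real_diff)
qed

section \<open>Equivalence of the three conditions\<close>

lemma generalized_state_iff:
  "generalized_state E s \<longleftrightarrow> (\<forall>a\<in>gcarrier E. s a \<ge> 0) \<and>
    (\<forall>a\<in>gcarrier E. \<forall>b\<in>gcarrier E. \<forall>c. gplus E a b = Some c \<longrightarrow> s a + s b = s c)"
  by (auto simp: generalized_state_def gea_morphism_def nonneg_real_gea_def)

section \<open>States and operator representations\<close>

text \<open>The index type consists of all real functions on the type of \<open>E\<close>, not only
  of members of \<open>S\<close>; this fixes the type of the Hilbert space independently of
  \<open>S\<close>.\<close>

lemma states_imp_operator_representation:
  fixes E :: "'a gea"
  assumes "has_order_determining_states E"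
  shows "has_operator_representation TYPE(('a \<Rightarrow> real) \<Rightarrow> complex) E"
proof -
  obtain S where S: "\<And>s. s \<in> S \<Longrightarrow> generalized_state E s" "order_determining E S"
    using assms by (auto simp: has_order_determining_states_def)
  \<comment> \<open>Functions outside \<open>S\<close> need be neither nonnegative nor additive; the
    coefficient 0 there keeps the operators positive and adds no condition to the order.\<close>
  define d where "d a s = (if s \<in> S then s a else 0)" for a :: 'a and s
  define \<phi> where "\<phi> a = diagonal_operator (d a)" for a
  let ?G = "ell2.positive_operator_gea finitely_supported"
  have d_nonneg: "d a s \<ge> 0" if "a \<in> gcarrier E" for a s
    using that S(1) by (auto simp: d_def generalized_state_iff)
  have "gea_morphism E ?G \<phi>"
    unfolding gea_morphism_def
  proof (intro conjI ballI allI impI funcsetI)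
    show "\<phi> a \<in> gcarrier ?G" if "a \<in> gcarrier E" for a
      unfolding \<phi>_def using that d_nonneg by (intro diagonal_operator_in_carrier)
    fix a b c
    assume ab: "a \<in> gcarrier E" "b \<in> gcarrier E" "gplus E a b = Some c"
    have "d c s = d a s + d b s" for s
      using ab S(1)[of s] by (auto simp: d_def generalized_state_iff)
    then show "gplus ?G (\<phi> a) (\<phi> b) = Some (\<phi> c)"
      by (auto simp: ell2.positive_operator_gea_def \<phi>_def diagonal_operator_def fun_eq_iff
          algebra_simps)
  qed
  moreover have "order_reflecting E ?G \<phi>"
    unfolding order_reflecting_def
  proof (intro ballI impI)
    fix a b
    assume ab: "a \<in> gcarrier E" "b \<in> gcarrier E" "gle ?G (\<phi> a) (\<phi> b)"
    have "d a s \<le> d b s" for s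
      using gle_diagonal_operator_imp_le[of "d a" "d b" s] ab d_nonneg by (simp add: \<phi>_def)
    then have "\<forall>s\<in>S. s a \<le> s b" by (metis d_def)
    then show "gle E a b" using S(2) ab by (simp add: order_determining_def)
  qed
  ultimately show ?thesis
    unfolding has_operator_representation_def
    using complex_hilbert_space_ell2 dense_finitely_supported by blast
qed

text \<open>The order of operators is comparison of their quadratic forms at all vectors of
  \<open>D\<close>, so the forms at the images of \<open>\<phi>\<close> give enough states. The
  ambient type \<open>'h\<close> is arbitrary.\<close>

lemma operator_representation_imp_states:
  assumes "has_operator_representation TYPE('h::ab_group_add) E"
  shows "has_order_determining_states E"
proof -
  obtain scale :: "complex \<Rightarrow> 'h \<Rightarrow> 'h" and H inner D \<phi> where
    hilbert: "complex_hilbert_space scale H inner" and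
    D: "complex_inner_product_space.dense_subspace scale H inner D" and
    morph: "gea_morphism E (complex_inner_product_space.positive_operator_gea scale H inner D) \<phi>" and
    refl: "order_reflecting E (complex_inner_product_space.positive_operator_gea scale H inner D) \<phi>"
    using assms unfolding has_operator_representation_def by blast
  interpret complex_hilbert_space scale H inner by (rule hilbert)
  have DH: "D \<subseteq> H" using D by (simp add: dense_subspace_def)
  \<comment> \<open>On images of carrier elements the forms take nonnegative real values, so
    \<open>Re\<close> loses nothing.\<close>
  define S where "S = (\<lambda>x a. Re (inner x (\<phi> a x))) ` D"
  have car: "\<phi> a \<in> gcarrier (positive_operator_gea D)" if "a \<in> gcarrier E" for a
    using morph that by (auto simp: gea_morphism_def)
  have pos: "inner x (\<phi> a x) \<in> \<real>\<^sub>\<ge>\<^sub>0" and op: "\<phi> a x \<in> H" if "a \<in> gcarrier E" "x \<in> D" for a x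
    using car[OF that(1)] that(2)
    by (auto simp: positive_operator_gea_def positive_on_def linear_operator_on_def)
  have "generalized_state E (\<lambda>a. Re (inner x (\<phi> a x)))" if x: "x \<in> D" for x
    unfolding generalized_state_iff
  proof (intro conjI ballI allI impI)
    show "0 \<le> Re (inner x (\<phi> a x))" if "a \<in> gcarrier E" for a
      using pos[OF that x] by (simp add: complex_nonneg_Reals_iff)
    fix a b c
    assume ab: "a \<in> gcarrier E" "b \<in> gcarrier E" "gplus E a b = Some c"
    then have "\<phi> c = (\<lambda>x\<in>D. \<phi> a x + \<phi> b x)"
      using morph by (auto simp: gea_morphism_def positive_operator_gea_def)
    then show "Re (inner x (\<phi> a x)) + Re (inner x (\<phi> b x)) = Re (inner x (\<phi> c x))"
      using x DH op ab by (simp add: inner_add_right subset_eq)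
  qed
  moreover have "order_determining E S"
    unfolding order_determining_def
  proof (intro ballI impI)
    fix a b
    assume ab: "a \<in> gcarrier E" "b \<in> gcarrier E" and le: "\<forall>s\<in>S. s a \<le> s b"
    have "inner x (\<phi> b x - \<phi> a x) \<in> \<real>\<^sub>\<ge>\<^sub>0" if x: "x \<in> D" for x
    proof -
      have "inner x (\<phi> b x - \<phi> a x) = inner x (\<phi> b x) - inner x (\<phi> a x)"
        using inner_add_right[of x "\<phi> b x" "- \<phi> a x"] inner_minus_right[of x "\<phi> a x"]
          x DH op ab subspace_neg[OF subspace_H] by (simp add: subset_eq)
      moreover have "Re (inner x (\<phi> a x)) \<le> Re (inner x (\<phi> b x))"
        using le x by (auto simp: S_def)
      \<comment> \<open>Both forms have imaginary part 0, so comparing real parts makes the complex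
        difference a nonnegative real.\<close>
      ultimately show ?thesis
        using pos[OF ab(1) x] pos[OF ab(2) x] by (auto simp: complex_nonneg_Reals_iff)
    qed
    then have "gle (positive_operator_gea D) (\<phi> a) (\<phi> b)"
      using gle_positive_operator_gea[OF D car car] ab by (simp add: positive_on_def)
    then show "gle E a b" using refl ab by (simp add: order_reflecting_def)
  qed
  ultimately show ?thesis
    unfolding has_order_determining_states_def by (intro exI[of _ S]) (auto simp: S_def)
qed

section \<open>States and powers of the nonnegative reals\<close>

text \<open>The index set is \<open>S\<close> itself and an element is sent to its family of values,
  so the componentwise order is comparison by all states in \<open>S\<close>.\<close>

lemma states_imp_power_representation:
  fixes E :: "'a gea"
  assumes "has_order_determining_states E"
  shows "has_power_representation TYPE('a \<Rightarrow> real) E"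
proof -
  obtain S where S: "\<And>s. s \<in> S \<Longrightarrow> generalized_state E s" "order_determining E S"
    using assms by (auto simp: has_order_determining_states_def)
  define \<phi> where "\<phi> a = (\<lambda>s\<in>S. s a)" for a :: 'a
  have car: "\<phi> a \<in> S \<rightarrow>\<^sub>E {0..}" if "a \<in> gcarrier E" for a
    using that S(1) by (auto simp: \<phi>_def generalized_state_iff)
  have "gea_morphism E (nonneg_real_power_gea S) \<phi>"
    using S(1) car
    by (auto simp: gea_morphism_def nonneg_real_power_gea_def generalized_state_iff \<phi>_def fun_eq_iff)
  moreover have "order_reflecting E (nonneg_real_power_gea S) \<phi>"
    using S(2) by (auto simp: order_reflecting_def order_determining_def
        gle_nonneg_real_power_gea car) (simp add: \<phi>_def)
  ultimately show ?thesis unfolding has_power_representation_def by blast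
qed

text \<open>Each coordinate of the representation is a state, and the componentwise order compares
  exactly these coordinates.\<close>

lemma power_representation_imp_states:
  assumes "has_power_representation TYPE('t) E"
  shows "has_order_determining_states E"
proof -
  obtain T :: "'t set" and \<phi> where
    morph: "gea_morphism E (nonneg_real_power_gea T) \<phi>" and
    refl: "order_reflecting E (nonneg_real_power_gea T) \<phi>"
    using assms unfolding has_power_representation_def by blast
  have car: "\<phi> a \<in> T \<rightarrow>\<^sub>E {0..}" if "a \<in> gcarrier E" for a
    using morph that by (auto simp: gea_morphism_def nonneg_real_power_gea_def)
  have "generalized_state E (\<lambda>a. \<phi> a t)" if t: "t \<in> T" for t
    unfolding generalized_state_iff
  proof (intro conjI ballI allI impI)
    show "0 \<le> \<phi> a t" if "a \<in> gcarrier E" for a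
      using PiE_mem[OF car[OF that] t] by simp
    fix a b c
    assume "a \<in> gcarrier E" "b \<in> gcarrier E" "gplus E a b = Some c"
    then have "\<phi> c = (\<lambda>t\<in>T. \<phi> a t + \<phi> b t)"
      using morph by (auto simp: gea_morphism_def nonneg_real_power_gea_def)
    then show "\<phi> a t + \<phi> b t = \<phi> c t" using t by simp
  qed
  moreover have "order_determining E ((\<lambda>t a. \<phi> a t) ` T)"
    unfolding order_determining_def
  proof (intro ballI impI)
    fix a b
    assume ab: "a \<in> gcarrier E" "b \<in> gcarrier E" and "\<forall>s\<in>(\<lambda>t a. \<phi> a t) ` T. s a \<le> s b"
    then have "gle (nonneg_real_power_gea T) (\<phi> a) (\<phi> b)"
      unfolding gle_nonneg_real_power_gea[OF car[OF ab(1)] car[OF ab(2)]] by simp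
    then show "gle E a b" using refl ab unfolding order_reflecting_def by blast
  qed
  ultimately show ?thesis
    unfolding has_order_determining_states_def
    by (intro exI[of _ "(\<lambda>t a. \<phi> a t) ` T"]) auto
qed

text \<open>Condition (i) involves no auxiliary type, so passing through it turns a representation
  over arbitrary types \<open>'h\<close> or \<open>'t\<close> into one over the fixed types. The
  last two conjuncts record this, so that the fixed types stand for existence over all
  types.\<close>

theorem theorem4p1:
  fixes E :: "'a gea"
  assumes "generalized_effect_algebra E"
  shows "(has_order_determining_states E \<longleftrightarrow>
            has_operator_representation TYPE(('a \<Rightarrow> real) \<Rightarrow> complex) E) \<and>
         (has_order_determining_states E \<longleftrightarrow>
            has_power_representation TYPE('a \<Rightarrow> real) E) \<and>
         (has_operator_representation TYPE('h::ab_group_add) E \<longrightarrow>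
            has_operator_representation TYPE(('a \<Rightarrow> real) \<Rightarrow> complex) E) \<and>
         (has_power_representation TYPE('t) E \<longrightarrow>
            has_power_representation TYPE('a \<Rightarrow> real) E)"
  by (intro conjI iffI impI)
    (auto intro: states_imp_operator_representation states_imp_power_representation
      dest: operator_representation_imp_states power_representation_imp_states)

end
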